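(* A set of objects $\mathcal{G}$ in $\mathsf{MS}$ is regularly co-generating if and only if, for every $n\in\{1\}\cup\{p^k\mid p\in\mathbb{P},\,k\in\{1,2,3,\dots\}\}$, there exists $G\in\mathcal{G}$ with two distinct elements, one having denominator $\nu_n$ and the other one $\nu_1$.
   Context: Supernatural numbers: let $\mathbb{P}$ be the set of primes and $\mathbb{N}=\{0,1,2,\dots\}$. A supernatural number is a function $\nu\colon\mathbb{P}\to\mathbb{N}\cup\{\infty\}$; $\mathcal{N}$ is the set of supernatural numbers, a complete lattice under the pointwise order. For $n\in\{1,2,3,\dots\}$, $\nu_n\in\mathcal{N}$ sends $p$ to the exponent of $p$ in the prime factorisation of $n$ (so $\nu_1$ is constantly $0$). $\mathcal{N}$ carries the topology with open basis $U_n=\{\nu\in\mathcal{N}\mid\nu\ge\nu_n\}$, $n\ge 1$. Multisets: a Boolean space is a compact Hausdorff space with a basis of clopen sets. The category $\mathsf{MS}$ of multisets has as objects the pairs $(X,\zeta_X)$ with $X$ a Boolean space and $\zeta_X\colon X\to\mathcal{N}$ continuous; an arrow $f\colon(X,\zeta_X)\to(Y,\zeta_Y)$ is a continuous function $f\colon X\to Y$ such that $\zeta_X(x)\ge\zeta_Y(f(x))$ for every $x\in X$. $\zeta_X(x)$ is called the denominator of $x$. The category $\mathsf{MS}$ is complete and cocomplete. A set of objects $\mathcal{G}$ in $\mathsf{MS}$ is regularly co-generating if, for every multiset $X$, the canonical arrow $X\to\prod_{G\in\mathcal{G},\,t\in\hom(X,G)}G$, whose $(G,t)$-component is $t$, is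 regular monic (i.e. an equaliser of some pair of parallel arrows in $\mathsf{MS}$). *)

theory Defs
  imports "HOL-Analysis.Analysis" "HOL-Computational_Algebra.Primes"
begin

typedef prime_number = "{p :: nat. prime p}" morphisms nat_of_prime prime_of_nat
  using two_is_prime_nat by blast

text \<open>The order, and the complete lattice structure, is the pointwise one of the function type.\<close>

type_synonym supernat = "prime_number \<Rightarrow> enat"

definition nu :: "nat \<Rightarrow> supernat" where
  "nu n = (\<lambda>p. enat (multiplicity (nat_of_prime p) n))"

definition supernat_topology :: "supernat topology" where
  "supernat_topology = topology (arbitrary union_of (\<lambda>V. \<exists>n\<ge>1. V = {\<nu>. nu n \<le> \<nu>}))"

definition boolean_space :: "'a topology \<Rightarrow> bool" where
  "boolean_space T \<longleftrightarrow> compact_space T \<and> Hausdorff_space T \<and>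
     openin T = arbitrary union_of (\<lambda>V. openin T V \<and> closedin T V)"

record 'a ms =
  ms_topology :: "'a topology"
  denom :: "'a \<Rightarrow> supernat"

abbreviation ms_points :: "'a ms \<Rightarrow> 'a set" where
  "ms_points X \<equiv> topspace (ms_topology X)"

text \<open>Denominator functions and arrows are only meaningful on the points of the space; outside
  they are normalised to \<^const>\<open>undefined\<close>, so that equality of objects and of arrows is
  HOL equality. The composite of arrows \<open>f\<close> from \<open>X\<close> and \<open>g\<close> is
  \<open>compose (ms_points X) g f\<close>.\<close>

definition is_ms :: "'a ms \<Rightarrow> bool" where
  "is_ms X \<longleftrightarrow> boolean_space (ms_topology X) \<and>
     continuous_map (ms_topology X) supernat_topology (denom X) \<and>
     denom X \<in> extensional (ms_points X)"

definition ms_hom :: "'a ms \<Rightarrow> 'b ms \<Rightarrow> ('a \<Rightarrow> 'b) set" where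
  "ms_hom X Y = {f \<in> extensional (ms_points X).
     continuous_map (ms_topology X) (ms_topology Y) f \<and>
     (\<forall>x\<in>ms_points X. denom Y (f x) \<le> denom X x)}"

text \<open>\<open>m\<close> is an equaliser of \<open>f, g : Y \<rightarrow> Z\<close>. Test objects \<open>W\<close> have to live on some type. The
  type of \<open>Y\<close> is large enough: lemma \<open>ms_equaliser_universal\<close> below extends the universal
  property to test objects on any type.\<close>

definition ms_equaliser ::
  "'x ms \<Rightarrow> 'y ms \<Rightarrow> 'z ms \<Rightarrow> ('x \<Rightarrow> 'y) \<Rightarrow> ('y \<Rightarrow> 'z) \<Rightarrow> ('y \<Rightarrow> 'z) \<Rightarrow> bool" where
  "ms_equaliser X Y Z m f g \<longleftrightarrow>
     is_ms X \<and> is_ms Y \<and> is_ms Z \<and> m \<in> ms_hom X Y \<and> f \<in> ms_hom Y Z \<and> g \<in> ms_hom Y Z \<and>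
     compose (ms_points X) f m = compose (ms_points X) g m \<and>
     (\<forall>(W :: 'y ms) h. is_ms W \<and> h \<in> ms_hom W Y \<and>
        compose (ms_points W) f h = compose (ms_points W) g h \<longrightarrow>
        (\<exists>!u. u \<in> ms_hom W X \<and> compose (ms_points W) m u = h))"

text \<open>The codomain \<open>Z\<close> of the parallel pair may be taken on the type \<open>'y + 'y\<close>: one may corestrict
  to the union of the two images. See lemma \<open>regular_monicI\<close> below.\<close>

definition regular_monic :: "'x ms \<Rightarrow> 'y ms \<Rightarrow> ('x \<Rightarrow> 'y) \<Rightarrow> bool" where
  "regular_monic X Y m \<longleftrightarrow> (\<exists>(Z :: ('y + 'y) ms) f g. ms_equaliser X Y Z m f g)"

text \<open>Arrows lower denominators, so in the categorical product the denominator of a family is the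
  supremum of the denominators of its components. See \<open>is_ms_ms_prod\<close> and \<open>ms_prod_universal\<close>.\<close>

definition ms_prod :: "'i set \<Rightarrow> ('i \<Rightarrow> 'a ms) \<Rightarrow> ('i \<Rightarrow> 'a) ms" where
  "ms_prod I F =
     \<lparr>ms_topology = product_topology (\<lambda>i. ms_topology (F i)) I,
      denom = (\<lambda>x \<in> (\<Pi>\<^sub>E i\<in>I. ms_points (F i)). SUP i\<in>I. denom (F i) (x i))\<rparr>"

definition cogen_index :: "'g ms set \<Rightarrow> 'x ms \<Rightarrow> ('g ms \<times> ('x \<Rightarrow> 'g)) set" where
  "cogen_index \<G> X = (SIGMA G:\<G>. ms_hom X G)"

definition canonical_arrow ::
  "'g ms set \<Rightarrow> 'x ms \<Rightarrow> 'x \<Rightarrow> ('g ms \<times> ('x \<Rightarrow> 'g)) \<Rightarrow> 'g" where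
  "canonical_arrow \<G> X = (\<lambda>x\<in>ms_points X. \<lambda>(G, t)\<in>cogen_index \<G> X. t x)"

text \<open>HOL cannot quantify over types inside a formula, hence the explicit type \<open>'x\<close> on which
  the multisets \<open>X\<close> live; it is independent of the type \<open>'g\<close> of the members of \<open>\<G>\<close>. On a one-element type the
  condition degenerates, as all multisets there have at most one point.\<close>

definition regularly_cogenerating :: "'x itself \<Rightarrow> 'g ms set \<Rightarrow> bool" where
  "regularly_cogenerating (_ :: 'x itself) \<G> \<longleftrightarrow>
     (\<forall>X :: 'x ms. is_ms X \<longrightarrow>
        regular_monic X (ms_prod (cogen_index \<G> X) fst) (canonical_arrow \<G> X))"

lemma nu_1: "nu 1 = bot"
  by (auto simp: nu_def fun_eq_iff bot_enat_def zero_enat_def)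

lemma nu_le_iff:
  assumes "n \<ge> 1"
  shows "nu n \<le> \<nu> \<longleftrightarrow> (\<forall>p. nat_of_prime p \<in> prime_factors n \<longrightarrow> nu n p \<le> \<nu> p)"
proof -
  have "nu n p = 0" if "nat_of_prime p \<notin> prime_factors n" for p
  proof -
    have "prime (nat_of_prime p)" using nat_of_prime[of p] by simp
    then have "multiplicity (nat_of_prime p) n = 0"
      using that assms by (simp add: in_prime_factors_iff not_dvd_imp_multiplicity_0)
    then show ?thesis by (simp add: nu_def zero_enat_def)
  qed
  then show ?thesis unfolding le_fun_def by (metis zero_le)
qed

lemma nu_lcm_le_iff:
  assumes "m \<ge> 1" "n \<ge> 1"
  shows "nu (lcm m n) \<le> \<nu> \<longleftrightarrow> nu m \<le> \<nu> \<and> nu n \<le> \<nu>"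
proof -
  have "multiplicity (nat_of_prime p) (lcm m n) =
      max (multiplicity (nat_of_prime p) m) (multiplicity (nat_of_prime p) n)" for p
    using assms nat_of_prime[of p] by (intro multiplicity_lcm) auto
  then have "nu (lcm m n) p = max (nu m p) (nu n p)" for p
    by (simp add: nu_def max_def)
  then show ?thesis by (auto simp: le_fun_def)
qed

lemma istopology_supernat:
  "istopology (arbitrary union_of (\<lambda>V. \<exists>n\<ge>1. V = {\<nu>. nu n \<le> \<nu>}))"
proof (rule istopology_base)
  fix S T assume "\<exists>n\<ge>1. S = {\<nu>. nu n \<le> \<nu>}" "\<exists>n\<ge>1. T = {\<nu>. nu n \<le> \<nu>}"
  then obtain m n where mn: "m \<ge> 1" "n \<ge> 1" and S: "S = {\<nu>. nu m \<le> \<nu>}" and T: "T = {\<nu>. nu n \<le> \<nu>}"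
    by blast
  have "S \<inter> T = {\<nu>. nu (lcm m n) \<le> \<nu>}" using mn by (auto simp: S T nu_lcm_le_iff)
  moreover have "lcm m n \<ge> 1" using mn by (metis One_nat_def Suc_leI lcm_pos_nat not_less_eq_eq zero_less_iff_neq_zero le_zero_eq)
  ultimately show "\<exists>n\<ge>1. S \<inter> T = {\<nu>. nu n \<le> \<nu>}" by blast
qed

lemma openin_supernat_topology:
  "openin supernat_topology = arbitrary union_of (\<lambda>V. \<exists>n\<ge>1. V = {\<nu>. nu n \<le> \<nu>})"
  unfolding supernat_topology_def using istopology_supernat by (rule topology_inverse')

lemma openin_supernat_basic: "n \<ge> 1 \<Longrightarrow> openin supernat_topology {\<nu>. nu n \<le> \<nu>}"
  unfolding openin_supernat_topology by (rule arbitrary_union_of_inc) blast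

lemma topspace_supernat_topology [simp]: "topspace supernat_topology = UNIV"
proof -
  have "{\<nu>. nu 1 \<le> \<nu>} \<subseteq> topspace supernat_topology"
    using openin_supernat_basic[of 1] openin_subset by blast
  then show ?thesis unfolding nu_1 by auto
qed

lemma continuous_map_supernat_iff:
  "continuous_map T supernat_topology f \<longleftrightarrow> (\<forall>n\<ge>1. openin T {x \<in> topspace T. nu n \<le> f x})"
proof (intro iffI allI impI)
  fix n :: nat
  assume "continuous_map T supernat_topology f" "n \<ge> 1"
  from openin_continuous_map_preimage[OF this(1) openin_supernat_basic[OF this(2)]]
  show "openin T {x \<in> topspace T. nu n \<le> f x}" by simp
next
  assume *: "\<forall>n\<ge>1. openin T {x \<in> topspace T. nu n \<le> f x}"
  show "continuous_map T supernat_topology f"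
    unfolding continuous_map
  proof (intro conjI allI impI)
    fix U assume "openin supernat_topology U"
    then have U: "\<forall>x\<in>U. \<exists>V. (\<exists>n\<ge>1. V = {\<nu>. nu n \<le> \<nu>}) \<and> x \<in> V \<and> V \<subseteq> U"
      by (simp only: openin_supernat_topology arbitrary_union_of_alt)
    show "openin T {x \<in> topspace T. f x \<in> U}"
    proof (subst openin_subopen, intro ballI)
      fix x assume x: "x \<in> {x \<in> topspace T. f x \<in> U}"
      with U obtain n where "n \<ge> 1" "nu n \<le> f x" "{\<nu>. nu n \<le> \<nu>} \<subseteq> U" by blast
      with x * show "\<exists>V. openin T V \<and> x \<in> V \<and> V \<subseteq> {x \<in> topspace T. f x \<in> U}"
        by (intro exI[of _ "{x \<in> topspace T. nu n \<le> f x}"]) auto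
    qed
  qed auto
qed

lemma boolean_spaceD:
  assumes "boolean_space T"
  shows "compact_space T" "Hausdorff_space T"
  by (rule assms[unfolded boolean_space_def, THEN conjunct1],
      rule assms[unfolded boolean_space_def, THEN conjunct2, THEN conjunct1])

lemma boolean_space_iff:
  "boolean_space T \<longleftrightarrow> compact_space T \<and> Hausdorff_space T \<and>
     (\<forall>U x. openin T U \<and> x \<in> U \<longrightarrow> (\<exists>V. openin T V \<and> closedin T V \<and> x \<in> V \<and> V \<subseteq> U))"
proof -
  have "openin T = arbitrary union_of (\<lambda>V. openin T V \<and> closedin T V) \<longleftrightarrow>
     (\<forall>U x. openin T U \<and> x \<in> U \<longrightarrow> (\<exists>V. openin T V \<and> closedin T V \<and> x \<in> V \<and> V \<subseteq> U))"
    (is "?L = ?R")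
  proof
    assume ?L
    show ?R
    proof (intro allI impI)
      fix U x assume U: "openin T U \<and> x \<in> U"
      with \<open>?L\<close> have "(arbitrary union_of (\<lambda>V. openin T V \<and> closedin T V)) U" by metis
      with U show "\<exists>V. openin T V \<and> closedin T V \<and> x \<in> V \<and> V \<subseteq> U"
        by (auto simp: arbitrary_union_of_alt)
    qed
  next
    assume R: ?R
    show ?L
    proof
      fix U
      show "openin T U = (arbitrary union_of (\<lambda>V. openin T V \<and> closedin T V)) U"
        unfolding arbitrary_union_of_alt
      proof
        show "\<forall>x\<in>U. \<exists>V. (openin T V \<and> closedin T V) \<and> x \<in> V \<and> V \<subseteq> U" if "openin T U"
          using R that by meson
        show "openin T U" if "\<forall>x\<in>U. \<exists>V. (openin T V \<and> closedin T V) \<and> x \<in> V \<and> V \<subseteq> U"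
          by (subst openin_subopen) (use that in meson)
      qed
    qed
  qed
  then show ?thesis by (simp add: boolean_space_def)
qed

lemma enat_le_SUP_iff:
  fixes f :: "'i \<Rightarrow> enat"
  assumes "k \<ge> 1"
  shows "enat k \<le> (SUP i\<in>I. f i) \<longleftrightarrow> (\<exists>i\<in>I. enat k \<le> f i)"
proof -
  have "enat k = eSuc (enat (k - 1))" using assms by (simp add: eSuc_enat)
  then have "enat k \<le> a \<longleftrightarrow> enat (k - 1) < a" for a
    by (metis ileI1 iless_eSuc0 eSuc_enat Suc_ile_eq enat_ord_simps)
  then show ?thesis by (simp add: less_SUP_iff)
qed

lemma is_ms_ms_prod:
  assumes "\<And>i. i \<in> I \<Longrightarrow> is_ms (F i)"
  shows "is_ms (ms_prod I F)"
proof -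
  let ?T = "product_topology (\<lambda>i. ms_topology (F i)) I"
  have bs: "boolean_space (ms_topology (F i))" if "i \<in> I" for i
    using assms[OF that] by (simp add: is_ms_def)
  have "compact_space ?T" using bs by (auto simp: compact_space_product_topology boolean_space_def)
  moreover have "Hausdorff_space ?T"
    using bs by (auto simp: Hausdorff_space_product_topology boolean_space_def)
  moreover have "\<exists>V. openin ?T V \<and> closedin ?T V \<and> x \<in> V \<and> V \<subseteq> U" if U: "openin ?T U" "x \<in> U" for U x
  proof -
    obtain B where fin: "finite {i \<in> I. B i \<noteq> ms_points (F i)}"
      and B: "\<And>i. i \<in> I \<Longrightarrow> openin (ms_topology (F i)) (B i)" and x: "x \<in> Pi\<^sub>E I B" and BU: "Pi\<^sub>E I B \<subseteq> U"
      using U(1)[unfolded openin_product_topology_alt, rule_format, OF U(2)] by (elim exE conjE) simp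
    have "\<exists>V. openin (ms_topology (F i)) V \<and> closedin (ms_topology (F i)) V \<and> x i \<in> V \<and> V \<subseteq> B i \<and>
        (B i = ms_points (F i) \<longrightarrow> V = ms_points (F i))" if i: "i \<in> I" for i
    proof (cases "B i = ms_points (F i)")
      case True
      then show ?thesis using x i by (intro exI[of _ "B i"]) (auto simp: PiE_iff)
    next
      case False
      moreover have "x i \<in> B i" using x i by auto
      ultimately show ?thesis using bs[OF i] B[OF i] unfolding boolean_space_iff by blast
    qed
    then obtain V where V: "\<And>i. i \<in> I \<Longrightarrow> openin (ms_topology (F i)) (V i) \<and>
        closedin (ms_topology (F i)) (V i) \<and> x i \<in> V i \<and> V i \<subseteq> B i \<and>
        (B i = ms_points (F i) \<longrightarrow> V i = ms_points (F i))" by metis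
    have "finite {i \<in> I. V i \<noteq> ms_points (F i)}"
      by (rule finite_subset[OF _ fin]) (use V in auto)
    then have "openin ?T (Pi\<^sub>E I V)" using V by (auto simp: openin_PiE_gen)
    moreover have "closedin ?T (Pi\<^sub>E I V)" using V by (auto simp: closedin_product_topology)
    moreover have "x \<in> Pi\<^sub>E I V" using V x by (auto simp: PiE_iff)
    moreover have "Pi\<^sub>E I V \<subseteq> U" using V BU by (meson PiE_mono order_trans)
    ultimately show ?thesis by blast
  qed
  ultimately have "boolean_space ?T" unfolding boolean_space_iff by blast
  moreover have "openin ?T {x \<in> topspace ?T. nu n \<le> denom (ms_prod I F) x}" if n: "n \<ge> 1" for n
  proof -
    let ?P = "{p. nat_of_prime p \<in> prime_factors n}"
    let ?A = "\<lambda>p i. {x \<in> topspace ?T. nu n p \<le> denom (F i) (x i)p}"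
    have fin: "finite ?P"
      by (rule finite_imageD[of nat_of_prime])
        (auto intro: finite_subset[of _ "prime_factors n"] simp: inj_on_def nat_of_prime_inject)
    have pos: "multiplicity (nat_of_prime p) n \<ge> 1" if "p \<in> ?P" for p
      using that n by (metis One_nat_def Suc_leI mem_Collect_eq prime_factors_multiplicity)
    have op: "openin ?T (?A p i)" if p: "p \<in> ?P" and i: "i \<in> I" for p i
    proof -
      let ?q = "nat_of_prime p ^ multiplicity (nat_of_prime p) n"
      have pr: "prime (nat_of_prime p)" using nat_of_prime[of p] by simp
      have q1: "?q \<ge> 1" using prime_gt_0_nat[OF pr] by (simp add: Suc_le_eq)
      have "nu ?q r \<le> \<nu> r" if "nu n p \<le> \<nu> p" for \<nu> r
      proof (cases "r = p")
        case True
        then show ?thesis using that pr by (simp add: nu_def)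
      next
        case False
        then have "nat_of_prime r \<noteq> nat_of_prime p" by (simp add: nat_of_prime_inject)
        moreover have "prime (nat_of_prime r)" using nat_of_prime[of r] by simp
        ultimately have "multiplicity (nat_of_prime r) ?q = 0"
          using pr by (metis multiplicity_distinct_prime_power)
        then show ?thesis by (simp add: nu_def zero_enat_def[symmetric])
      qed
      moreover have "nu ?q p = nu n p" using pr by (simp add: nu_def)
      ultimately have eq: "nu n p \<le> \<nu> p \<longleftrightarrow> nu ?q \<le> \<nu>" for \<nu>
        unfolding le_fun_def by metis
      have c: "continuous_map ?T supernat_topology (denom (F i) \<circ> (\<lambda>x. x i))"
        using assms[OF i] unfolding is_ms_def
        by (intro continuous_map_compose[OF continuous_map_product_projection[OF i]]) auto
      show ?thesis
        using c[unfolded continuous_map_supernat_iff, rule_format, OF q1] by (simp add: eq)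
    qed
    have "{x \<in> topspace ?T. nu n \<le> denom (ms_prod I F) x} =
        topspace ?T \<inter> \<Inter>((\<lambda>p. \<Union>i\<in>I. ?A p i) ` ?P)"
    proof -
      have "nu n \<le> (SUP i\<in>I. denom (F i) (x i)) \<longleftrightarrow> (\<forall>p\<in>?P. \<exists>i\<in>I. nu n p \<le> denom (F i) (x i) p)" for x
      proof -
        have "nu n p \<le> (SUP i\<in>I. denom (F i) (x i) p) \<longleftrightarrow> (\<exists>i\<in>I. nu n p \<le> denom (F i) (x i) p)"
          if "p \<in> ?P" for p
          unfolding nu_def using pos[OF that] by (rule enat_le_SUP_iff)
        then show ?thesis unfolding nu_le_iff[OF n] by (auto simp: image_image)
      qed
      then show ?thesis by (auto simp: ms_prod_def)
    qed
    moreover have "openin ?T (topspace ?T \<inter> \<Inter>((\<lambda>p. \<Union>i\<in>I. ?A p i) ` ?P))"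
      using fin op by (intro openin_Int_Inter openin_topspace) auto
    ultimately show ?thesis by simp
  qed
  moreover have "denom (ms_prod I F) \<in> extensional (topspace ?T)"
    by (simp add: ms_prod_def)
  ultimately show ?thesis
    by (simp add: is_ms_def continuous_map_supernat_iff) (simp add: ms_prod_def)
qed

lemma ms_prod_universal:
  assumes "\<And>i. i \<in> I \<Longrightarrow> is_ms (F i)"
  defines "P \<equiv> ms_prod I F" and "\<pi> \<equiv> \<lambda>i. \<lambda>x\<in>ms_points (ms_prod I F). x i"
  shows "\<And>i. i \<in> I \<Longrightarrow> \<pi> i \<in> ms_hom P (F i)"
    and "\<And>Z :: 'z ms. \<And>h. is_ms Z \<Longrightarrow> (\<And>i. i \<in> I \<Longrightarrow> h i \<in> ms_hom Z (F i)) \<Longrightarrow>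
      \<exists>!u. u \<in> ms_hom Z P \<and> (\<forall>i\<in>I. compose (ms_points Z) (\<pi> i) u = h i)"
proof -
  have pts: "ms_points P = (\<Pi>\<^sub>E i\<in>I. ms_points (F i))" by (simp add: P_def ms_prod_def)
  have den: "denom P x = (SUP i\<in>I. denom (F i) (x i))" if "x \<in> ms_points P" for x
    using that by (simp add: P_def ms_prod_def)
  have top: "ms_topology P = product_topology (\<lambda>i. ms_topology (F i)) I"
    by (simp add: P_def ms_prod_def)
  show "\<pi> i \<in> ms_hom P (F i)" if "i \<in> I" for i
  proof -
    have "continuous_map (ms_topology P) (ms_topology (F i)) (\<pi> i)"
      using continuous_map_product_projection[OF that, of "\<lambda>i. ms_topology (F i)"]
      unfolding top[symmetric] by (rule continuous_map_eq) (simp add: \<pi>_def P_def)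
    then show ?thesis using that
      by (auto simp: ms_hom_def den P_def[symmetric] \<pi>_def intro: SUP_upper)
  qed
  fix Z :: "'z ms" and h
  assume Z: "is_ms Z" and h: "\<And>i. i \<in> I \<Longrightarrow> h i \<in> ms_hom Z (F i)"
  have hc: "continuous_map (ms_topology Z) (ms_topology (F i)) (h i)"
    and hd: "x \<in> ms_points Z \<Longrightarrow> denom (F i) (h i x) \<le> denom Z x"
    and he: "h i \<in> extensional (ms_points Z)" if "i \<in> I" for i x
    using h[OF that] by (auto simp: ms_hom_def)
  define u where "u = (\<lambda>z\<in>ms_points Z. \<lambda>i\<in>I. h i z)"
  have uc: "continuous_map (ms_topology Z) (ms_topology P) u"
    unfolding top continuous_map_componentwise
    by (auto simp: u_def intro: continuous_map_eq[OF hc])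
  have upts: "u z \<in> ms_points P" if "z \<in> ms_points Z" for z
    using uc that by (auto simp: continuous_map_def)
  have uh: "u \<in> ms_hom Z P"
    using uc by (auto simp: ms_hom_def den[OF upts] u_def[symmetric] intro!: SUP_least)
      (auto simp: u_def hd)
  have uq: "compose (ms_points Z) (\<pi> i) u = h i" if "i \<in> I" for i
  proof (rule extensionalityI[of _ "ms_points Z"])
    show "compose (ms_points Z) (\<pi> i) u \<in> extensional (ms_points Z)" by (rule compose_extensional)
    show "compose (ms_points Z) (\<pi> i) u x = h i x" if "x \<in> ms_points Z" for x
      using that \<open>i \<in> I\<close> upts[OF that]
      by (simp add: compose_def \<pi>_def P_def[symmetric]) (simp add: u_def)
  qed (rule he[OF that])
  show "\<exists>!u. u \<in> ms_hom Z P \<and> (\<forall>i\<in>I. compose (ms_points Z) (\<pi> i) u = h i)"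
  proof (rule ex1I[of _ u])
    show "u \<in> ms_hom Z P \<and> (\<forall>i\<in>I. compose (ms_points Z) (\<pi> i) u = h i)" using uh uq by blast
    fix v assume v: "v \<in> ms_hom Z P \<and> (\<forall>i\<in>I. compose (ms_points Z) (\<pi> i) v = h i)"
    show "v = u"
    proof (rule extensionalityI[of _ "ms_points Z"])
      show "v \<in> extensional (ms_points Z)" "u \<in> extensional (ms_points Z)"
        using v uh by (auto simp: ms_hom_def)
      fix z assume z: "z \<in> ms_points Z"
      have vz: "v z \<in> ms_points P" using v z by (auto simp: ms_hom_def continuous_map_def)
      have "v z i = u z i" if "i \<in> I" for i
      proof -
        have "compose (ms_points Z) (\<pi> i) v z = compose (ms_points Z) (\<pi> i) u z"
          using v uq that by simp
        then show ?thesis using z vz upts[OF z] by (simp add: compose_def \<pi>_def P_def[symmetric])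
      qed
      then show "v z = u z" using vz upts[OF z] unfolding pts by (meson PiE_ext)
    qed
  qed
qed

lemma compose_eq_compose_iff:
  "compose A f h = compose A g h \<longleftrightarrow> (\<forall>w\<in>A. f (h w) = g (h w))"
  by (auto simp: compose_def restrict_def fun_eq_iff)

lemma ms_homD:
  assumes "f \<in> ms_hom X Y"
  shows "f \<in> extensional (ms_points X)" "continuous_map (ms_topology X) (ms_topology Y) f"
    "\<And>x. x \<in> ms_points X \<Longrightarrow> f x \<in> ms_points Y"
    "\<And>x. x \<in> ms_points X \<Longrightarrow> denom Y (f x) \<le> denom X x"
  using assms by (auto simp: ms_hom_def continuous_map_def)

lemma ms_homI:
  assumes "f \<in> extensional (ms_points X)" "continuous_map (ms_topology X) (ms_topology Y) f"
    "\<And>x. x \<in> ms_points X \<Longrightarrow> denom Y (f x) \<le> denom X x"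
  shows "f \<in> ms_hom X Y"
  using assms by (auto simp: ms_hom_def)

lemma ms_hom_compose:
  assumes f: "f \<in> ms_hom X Y" and g: "g \<in> ms_hom Y Z"
  shows "compose (ms_points X) g f \<in> ms_hom X Z"
proof (rule ms_homI)
  show "continuous_map (ms_topology X) (ms_topology Z) (compose (ms_points X) g f)"
    by (rule continuous_map_eq[OF continuous_map_compose[OF ms_homD(2)[OF f] ms_homD(2)[OF g]]])
      (simp add: compose_def)
  show "denom Z (compose (ms_points X) g f x) \<le> denom X x" if "x \<in> ms_points X" for x
    using order_trans[OF ms_homD(4)[OF g ms_homD(3)[OF f that]] ms_homD(4)[OF f that]] that
    by (simp add: compose_def)
qed (rule compose_extensional)

lemma ms_hom_image_closedin:
  assumes "is_ms X" "is_ms Y" "f \<in> ms_hom X Y"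
  shows "closedin (ms_topology Y) (f ` ms_points X)"
proof -
  have "compact_space (ms_topology X)" "Hausdorff_space (ms_topology Y)"
    using assms boolean_spaceD unfolding is_ms_def by blast+
  then show ?thesis
    using compactin_imp_closedin image_compactin ms_homD(2)[OF assms(3)] unfolding compact_space_def
    by blast
qed

lemma ms_copy:
  assumes Z: "is_ms Z" and A: "closedin (ms_topology Z) A" and j: "inj_on j A"
  obtains M where "is_ms M" "ms_points M = j ` A" "restrict (inv_into A j) (j ` A) \<in> ms_hom M Z"
    "\<And>(W :: 'w ms) h. h \<in> ms_hom W Z \<Longrightarrow>
      h ` ms_points W \<subseteq> A \<Longrightarrow> compose (ms_points W) j h \<in> ms_hom W M"
proof -
  define k where "k = inv_into A j"
  have kj: "k (j a) = a" if "a \<in> A" for a using that j by (simp add: k_def)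
  let ?Z = "ms_topology Z"
  define T where "T = pullback_topology (j ` A) k ?Z"
  define M where "M = \<lparr>ms_topology = T, denom = (\<lambda>x\<in>j ` A. denom Z (k x))\<rparr>"
  have Asub: "A \<subseteq> topspace ?Z" using A closedin_subset by blast
  have topT: "topspace T = j ` A"
    unfolding T_def topspace_pullback_topology using Asub kj by auto
  have openT: "openin T S \<longleftrightarrow> (\<exists>U. openin ?Z U \<and> S = k -` U \<inter> j ` A)" for S
    unfolding T_def by (rule openin_pullback_topology)
  have kcont: "continuous_map T ?Z k"
    unfolding continuous_map topT openT using Asub kj by (auto simp: vimage_def)
  have jcont: "continuous_map (subtopology ?Z A) T j"
    unfolding continuous_map topT
  proof (intro conjI allI impI)
    show "j ` topspace (subtopology ?Z A) \<subseteq> j ` A" by auto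
    fix S assume "openin T S"
    then obtain U where U: "openin ?Z U" "S = k -` U \<inter> j ` A" unfolding openT by blast
    have "{x \<in> topspace (subtopology ?Z A). j x \<in> S} = U \<inter> A"
    proof -
      have "j x \<in> S \<longleftrightarrow> x \<in> U" if "x \<in> A" for x
        using kj[OF that] that by (simp add: U(2))
      then show ?thesis using Asub by auto
    qed
    then show "openin (subtopology ?Z A) {x \<in> topspace (subtopology ?Z A). j x \<in> S}"
      using U(1) by (auto simp: openin_subtopology)
  qed
  have "homeomorphic_maps (subtopology ?Z A) T j k"
    unfolding homeomorphic_maps_def using jcont kcont kj topT
    by (auto simp: continuous_map_in_subtopology)
  then have hs: "subtopology ?Z A homeomorphic_space T" by (auto simp: homeomorphic_space_def)
  have bZ: "boolean_space ?Z" using Z by (simp add: is_ms_def)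
  have "compact_space (subtopology ?Z A)"
    using A boolean_spaceD(1)[OF bZ] by (meson closedin_compact_space compact_space_subtopology)
  then have "compact_space T" using hs homeomorphic_compact_space by blast
  moreover have "Hausdorff_space T"
    using homeomorphic_Hausdorff_space[OF hs] Hausdorff_space_subtopology[OF boolean_spaceD(2)[OF bZ]]
    by blast
  moreover have "\<exists>V. openin T V \<and> closedin T V \<and> x \<in> V \<and> V \<subseteq> U" if "openin T U" "x \<in> U" for U x
  proof -
    obtain U' where U': "openin ?Z U'" "U = k -` U' \<inter> j ` A"
      using \<open>openin T U\<close>[unfolded openT] by (elim exE conjE)
    then have "k x \<in> U'" using \<open>x \<in> U\<close> by simp
    then have "\<exists>V. openin ?Z V \<and> closedin ?Z V \<and> k x \<in> V \<and> V \<subseteq> U'"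
      using bZ[unfolded boolean_space_iff] U'(1) by meson
    then obtain V where V: "openin ?Z V" "closedin ?Z V" "k x \<in> V" "V \<subseteq> U'" by (elim exE conjE)
    have eq: "{x \<in> topspace T. k x \<in> V} = k -` V \<inter> j ` A" unfolding topT by auto
    have "closedin T (k -` V \<inter> j ` A)"
      using closedin_continuous_map_preimage[OF kcont V(2)] unfolding eq .
    moreover have "openin T (k -` V \<inter> j ` A)" unfolding openT using V(1) by (intro exI[of _ V]) simp
    moreover have "x \<in> k -` V \<inter> j ` A" "k -` V \<inter> j ` A \<subseteq> U" using V U' that(2) by auto
    ultimately show ?thesis by (intro exI conjI)
  qed
  ultimately have "boolean_space T" unfolding boolean_space_iff by blast
  moreover have "continuous_map T supernat_topology (\<lambda>x\<in>j ` A. denom Z (k x))"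
  proof (rule continuous_map_eq)
    show "continuous_map T supernat_topology (denom Z \<circ> k)"
      using Z kcont continuous_map_compose unfolding is_ms_def by blast
  qed (simp add: topT)
  ultimately have M: "is_ms M" by (simp add: is_ms_def M_def topT)
  have ptsM: "ms_points M = j ` A" by (simp add: M_def topT)
  have kM: "restrict k (j ` A) \<in> ms_hom M Z"
  proof (rule ms_homI)
    show "continuous_map (ms_topology M) ?Z (restrict k (j ` A))"
      unfolding M_def using kcont by (auto intro: continuous_map_eq simp: topT)
  qed (auto simp: M_def topT)
  have jM: "compose (ms_points W) j h \<in> ms_hom W M"
    if h: "h \<in> ms_hom W Z" and hA: "h ` ms_points W \<subseteq> A" for W :: "'w ms" and h
  proof (rule ms_homI)
    have "continuous_map (ms_topology W) (subtopology ?Z A) h"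
      using ms_homD(2)[OF h] hA by (auto simp: continuous_map_in_subtopology)
    from continuous_map_compose[OF this jcont]
    show "continuous_map (ms_topology W) (ms_topology M) (compose (ms_points W) j h)"
      unfolding M_def by (auto intro: continuous_map_eq simp: compose_def)
    show "denom M (compose (ms_points W) j h x) \<le> denom W x" if "x \<in> ms_points W" for x
    proof -
      have "h x \<in> A" using hA that by blast
      then show ?thesis using that ms_homD(4)[OF h that] by (simp add: compose_def M_def kj)
    qed
  qed (rule compose_extensional)
  show thesis using that[OF M ptsM] kM jM unfolding k_def by blast
qed

lemma ms_equaliser_inj:
  assumes eq: "ms_equaliser X Y Z m f g"
  shows "inj_on m (ms_points X)"
proof (rule inj_onI)
  fix x x' assume x: "x \<in> ms_points X" and x': "x' \<in> ms_points X" and mx: "m x = m x'"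
  define P where "P = \<lparr>ms_topology = discrete_topology {m x},
    denom = (\<lambda>_\<in>{m x}. sup (denom X x) (denom X x'))\<rparr>"
  have "boolean_space (discrete_topology {m x})"
    unfolding boolean_space_iff by (auto simp: compact_space_discrete_topology)
  then have P: "is_ms P" by (simp add: P_def is_ms_def)
  have pt: "(\<lambda>_\<in>{m x}. y) \<in> ms_hom P X" if "y \<in> {x, x'}" for y
    using that x x' by (intro ms_homI) (auto simp: P_def)
  let ?h = "\<lambda>_\<in>{m x}. m x"
  have m: "m \<in> ms_hom X Y" using eq by (simp add: ms_equaliser_def)
  have comp: "compose (ms_points P) m (\<lambda>_\<in>{m x}. y) = ?h" if "y \<in> {x, x'}" for y
    using that mx by (auto simp: compose_def P_def fun_eq_iff restrict_def)
  have h: "?h \<in> ms_hom P Y" using ms_hom_compose[OF pt m, of x] comp[of x] by simp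
  have "f (m x) = g (m x)"
    using eq x unfolding ms_equaliser_def compose_eq_compose_iff by blast
  then have "compose (ms_points P) f ?h = compose (ms_points P) g ?h"
    unfolding compose_eq_compose_iff by (simp add: P_def)
  then have "\<exists>!u. u \<in> ms_hom P X \<and> compose (ms_points P) m u = ?h"
    using eq P h unfolding ms_equaliser_def by blast
  then have "(\<lambda>_\<in>{m x}. x) = (\<lambda>_\<in>{m x}. x')" using pt comp by blast
  then show "x = x'" by (metis insertI1 restrict_apply')
qed

lemma ms_equaliser_universal:
  fixes W :: "'w ms"
  assumes eq: "ms_equaliser X Y Z m f g"
    and W: "is_ms W" and h: "h \<in> ms_hom W Y"
    and fgh: "compose (ms_points W) f h = compose (ms_points W) g h"
  shows "\<exists>!u. u \<in> ms_hom W X \<and> compose (ms_points W) m u = h"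
proof -
  have Y: "is_ms Y" using eq by (simp add: ms_equaliser_def)
  let ?A = "h ` ms_points W"
  have "closedin (ms_topology Y) ?A" using W Y h by (rule ms_hom_image_closedin)
  from ms_copy[OF Y this, of id]
  obtain M where M: "is_ms M" "ms_points M = ?A"
    and i: "restrict (inv_into ?A id) ?A \<in> ms_hom M Y"
    and c: "compose (ms_points W) id h \<in> ms_hom W M"
    using h by (metis image_id inj_on_id id_apply subset_refl)
  let ?i = "restrict (inv_into ?A id) ?A"
  have ii: "?i y = y" if "y \<in> ?A" for y using that inv_into_f_f[of id ?A y] by simp
  have "compose (ms_points M) f ?i = compose (ms_points M) g ?i"
    unfolding compose_eq_compose_iff M(2) using fgh ii unfolding compose_eq_compose_iff by auto
  then obtain v where v: "v \<in> ms_hom M X" "compose (ms_points M) m v = ?i"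
    using eq M i unfolding ms_equaliser_def by blast
  have mv: "m (v y) = y" if "y \<in> ?A" for y
    using v(2) ii[OF that] that M(2) by (metis compose_eq)
  let ?u = "compose (ms_points W) v (compose (ms_points W) id h)"
  have "compose (ms_points W) m ?u = h"
  proof (rule extensionalityI[OF compose_extensional ms_homD(1)[OF h]])
    show "compose (ms_points W) m ?u w = h w" if "w \<in> ms_points W" for w
      using that mv by (simp add: compose_eq)
  qed
  moreover have "?u \<in> ms_hom W X" using ms_hom_compose[OF c v(1)] .
  moreover have "u = u'" if u: "u \<in> ms_hom W X \<and> compose (ms_points W) m u = h"
    and u': "u' \<in> ms_hom W X \<and> compose (ms_points W) m u' = h" for u u'
  proof (rule extensionalityI[of _ "ms_points W"])
    fix w assume w: "w \<in> ms_points W"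
    have "m (u w) = m (u' w)" using u u' w by (metis compose_eq)
    then show "u w = u' w"
      using ms_equaliser_inj[OF eq] ms_homD(3) u u' w by (metis inj_onD)
  qed (use u u' ms_homD(1) in blast)+
  ultimately show ?thesis by blast
qed

lemma regular_monicI:
  fixes X :: "'x ms" and Y :: "'y ms" and Z :: "'z ms"
  assumes eq: "ms_equaliser X Y Z m f g"
  shows "regular_monic X Y m"
proof -
  let ?Y = "ms_points Y"
  have X: "is_ms X" and Y: "is_ms Y" and Z: "is_ms Z" and m: "m \<in> ms_hom X Y"
    and f: "f \<in> ms_hom Y Z" and g: "g \<in> ms_hom Y Z"
    using eq by (auto simp: ms_equaliser_def)
  define A where "A = f ` ?Y \<union> g ` ?Y"
  define j where "j z = (if z \<in> f ` ?Y then Inl (inv_into ?Y f z) else Inr (inv_into ?Y g z))" for z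
  have clA: "closedin (ms_topology Z) A" unfolding A_def
    using ms_hom_image_closedin[OF Y Z f] ms_hom_image_closedin[OF Y Z g] by (rule closedin_Un)
  have inj: "inj_on j A"
    by (rule inj_onI) (auto simp: A_def j_def split: if_splits dest: inv_into_injective)
  obtain M where M: "is_ms M" and "ms_points M = j ` A"
    and "restrict (inv_into A j) (j ` A) \<in> ms_hom M Z"
    and c: "\<And>(W :: 'y ms) h. h \<in> ms_hom W Z \<Longrightarrow>
      h ` ms_points W \<subseteq> A \<Longrightarrow> compose (ms_points W) j h \<in> ms_hom W M"
    by (rule ms_copy[where 'w = 'y, OF Z clA inj]) (rule that)
  let ?f = "compose ?Y j f" and ?g = "compose ?Y j g"
  have fg: "?f \<in> ms_hom Y M" "?g \<in> ms_hom Y M" using c[OF f] c[OF g] by (auto simp: A_def)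
  have pw: "?f y = ?g y \<longleftrightarrow> f y = g y" if "y \<in> ?Y" for y
    using that inj_on_eq_iff[OF inj, of "f y" "g y"] by (simp add: compose_eq A_def)
  have fgm: "compose (ms_points X) f m = compose (ms_points X) g m"
    using eq unfolding ms_equaliser_def by (elim conjE)
  have fgm': "compose (ms_points X) ?f m = compose (ms_points X) ?g m"
    using fgm pw ms_homD(3)[OF m] unfolding compose_eq_compose_iff by simp
  have "ms_equaliser X Y M m ?f ?g"
    unfolding ms_equaliser_def
  proof (intro conjI allI impI)
    fix W :: "'y ms" and h
    assume "is_ms W \<and> h \<in> ms_hom W Y \<and> compose (ms_points W) ?f h = compose (ms_points W) ?g h"
    then have W: "is_ms W" and h: "h \<in> ms_hom W Y"
      and "compose (ms_points W) ?f h = compose (ms_points W) ?g h" by blast+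
    then have "compose (ms_points W) f h = compose (ms_points W) g h"
      using pw ms_homD(3)[OF h] unfolding compose_eq_compose_iff by simp
    with eq W h show "\<exists>!u. u \<in> ms_hom W X \<and> compose (ms_points W) m u = h"
      by (rule ms_equaliser_universal)
  qed (rule X Y M m fg fgm')+
  then show ?thesis unfolding regular_monic_def by blast
qed

end

theory Submission
  imports Defs
begin

text \<open>An arrow is regular monic exactly when it is injective and preserves denominators. Necessity
  of the second condition is seen by testing against one-point multisets. For sufficiency, the image
  of the arrow is a closed set, hence an intersection of clopens, and so it is the equaliser of two
  maps into a power of the two-point multiset with denominators \<open>\<nu>\<^sub>1\<close>. Injectivity of the canonical
  arrow is governed by the pairs of points with denominators \<open>\<nu>\<^sub>1\<close>, preservation of
  denominators by the pairs with denominators \<open>\<nu>\<^bsub>p^k\<^esub>\<close> and \<open>\<nu>\<^sub>1\<close>, because a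
  supernatural number is the supremum of the \<open>\<nu>\<^bsub>p^k\<^esub>\<close> below it. Conversely these pairs are
  found by applying the condition to two-point multisets.\<close>

section \<open>Prime powers and the order on supernatural numbers\<close>

lemma nu_prime_power_apply:
  assumes "prime p"
  shows "nu (p ^ k) q = (if nat_of_prime q = p then enat k else 0)"
proof -
  have "prime (nat_of_prime q)" using nat_of_prime[of q] by simp
  then show ?thesis
    using assms by (auto simp: nu_def zero_enat_def multiplicity_distinct_prime_power)
qed

lemma nu_prime_power_le_iff: "nu (nat_of_prime p ^ k) \<le> \<nu> \<longleftrightarrow> enat k \<le> \<nu> p"
proof -
  have "prime (nat_of_prime p)" using nat_of_prime[of p] by simp
  then show ?thesis by (auto simp: le_fun_def nu_prime_power_apply nat_of_prime_inject)
qed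

text \<open>At each prime an element of \<open>enat\<close> is determined by the finite
  \<open>k\<close> below it, and \<open>k = 0\<close> gives no condition. This reduces inequalities
  of denominators to prime powers.\<close>

lemma supernat_leI:
  assumes "\<And>p k. k \<ge> 1 \<Longrightarrow> nu (nat_of_prime p ^ k) \<le> \<mu> \<Longrightarrow> nu (nat_of_prime p ^ k) \<le> \<nu>"
  shows "\<mu> \<le> \<nu>"
proof (rule le_funI)
  fix p
  have *: "enat k \<le> \<nu> p" if "enat k \<le> \<mu> p" for k
    using assms[of k p] that by (cases "k = 0") (auto simp: nu_prime_power_le_iff zero_enat_def[symmetric])
  show "\<mu> p \<le> \<nu> p"
  proof (cases "\<mu> p")
    case (enat k)
    then show ?thesis using *[of k] by simp
  next
    case infinity
    \<comment> \<open>Shifting to \<open>Suc k\<close> makes the bound strict, so no finite value of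
      \<open>\<nu> p\<close> survives.\<close>
    then have "enat k < \<nu> p" for k using *[of "Suc k"] by (simp add: Suc_ile_eq)
    then have "\<nu> p = \<infinity>" by (metis enat.exhaust less_irrefl)
    then show ?thesis by simp
  qed
qed

section \<open>Finite discrete multisets as test objects\<close>

definition discrete_ms :: "'a set \<Rightarrow> ('a \<Rightarrow> supernat) \<Rightarrow> 'a ms" where
  "discrete_ms S d = \<lparr>ms_topology = discrete_topology S, denom = restrict d S\<rparr>"

lemma ms_points_discrete_ms [simp]: "ms_points (discrete_ms S d) = S"
  by (simp add: discrete_ms_def)

lemma denom_discrete_ms [simp]: "x \<in> S \<Longrightarrow> denom (discrete_ms S d) x = d x"
  by (simp add: discrete_ms_def)

lemma is_ms_discrete_ms:
  assumes "finite S"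
  shows "is_ms (discrete_ms S d)"
proof -
  have "boolean_space (discrete_topology S)"
    unfolding boolean_space_iff using assms by (auto simp: compact_space_discrete_topology)
  then show ?thesis by (simp add: is_ms_def discrete_ms_def)
qed

lemma restrict_in_ms_hom_discrete_ms:
  assumes "f \<in> S \<rightarrow> ms_points Y" "\<And>x. x \<in> S \<Longrightarrow> denom Y (f x) \<le> d x"
  shows "restrict f S \<in> ms_hom (discrete_ms S d) Y"
  using assms by (intro ms_homI) (auto simp: discrete_ms_def)

text \<open>The point \<open>m x\<close>, with its denominator in \<open>Y\<close>, is a one-point
  test object that \<open>f\<close> and \<open>g\<close> do not distinguish. It factors through
  \<open>X\<close>, by injectivity at \<open>x\<close>, and the factor lowers denominators.\<close>

lemma ms_equaliser_denom:
  assumes eq: "ms_equaliser X Y Z m f g" and x: "x \<in> ms_points X"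
  shows "denom Y (m x) = denom X x"
proof (rule antisym)
  have m: "m \<in> ms_hom X Y" and fg: "f (m x) = g (m x)"
    using eq x unfolding ms_equaliser_def compose_eq_compose_iff by auto
  show "denom Y (m x) \<le> denom X x" using ms_homD(4)[OF m x] .
  let ?W = "discrete_ms {m x} (\<lambda>_. denom Y (m x))"
  let ?h = "\<lambda>y\<in>{m x}. y"
  have "?h \<in> ms_hom ?W Y"
    using ms_homD(3)[OF m x] by (intro restrict_in_ms_hom_discrete_ms) auto
  then obtain u where u: "u \<in> ms_hom ?W X" "compose {m x} m u = ?h"
    using ms_equaliser_universal[OF eq is_ms_discrete_ms, of "{m x}" ?h "\<lambda>_. denom Y (m x)"] fg
    by (auto simp: compose_eq_compose_iff)
  have "m (u (m x)) = m x" using fun_cong[OF u(2), of "m x"] by (simp add: compose_eq)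
  then have "u (m x) = x"
    using inj_onD[OF ms_equaliser_inj[OF eq]] ms_homD(3)[OF u(1)] x by simp
  then show "denom X x \<le> denom Y (m x)" using ms_homD(4)[OF u(1), of "m x"] by simp
qed

section \<open>Clopen sets and two-valued arrows\<close>

lemma boolean_space_clopen_outside_closed:
  assumes T: "boolean_space T" and A: "closedin T A" and y: "y \<in> topspace T - A"
  obtains C where "openin T C" "closedin T C" "A \<subseteq> C" "y \<notin> C"
proof -
  have "openin T (topspace T - A)" using A by blast
  then obtain V where "openin T V" "closedin T V" "y \<in> V" "V \<subseteq> topspace T - A"
    using T y unfolding boolean_space_iff by meson
  then show thesis using that[of "topspace T - V"] closedin_subset[OF A] by blast
qed

lemma continuous_map_if_clopen:
  assumes "openin T V" "closedin T V" "a \<in> topspace U" "b \<in> topspace U"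
  shows "continuous_map T U (\<lambda>z. if z \<in> V then a else b)"
  unfolding continuous_map
proof (intro conjI allI impI)
  fix S assume "openin U S"
  have "openin T (topspace T - V)" using assms(2) by blast
  moreover have "{x \<in> topspace T. (if x \<in> V then a else b) \<in> S} =
      (if a \<in> S then V else {}) \<union> (if b \<in> S then topspace T - V else {})"
    using openin_subset[OF assms(1)] by auto
  ultimately show "openin T {x \<in> topspace T. (if x \<in> V then a else b) \<in> S}"
    using assms(1) by auto
qed (use assms in auto)

text \<open>Every arrow that has to be constructed into a given \<open>G\<close> is of this form:
  the value \<open>b\<close> has the least denominator, so only the points of \<open>V\<close>
  impose a condition.\<close>

lemma two_valued_ms_hom:
  assumes "openin (ms_topology X) V" "closedin (ms_topology X) V"
    and "a \<in> ms_points G" "b \<in> ms_points G"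
    and "\<And>z. z \<in> V \<Longrightarrow> denom G a \<le> denom X z" "denom G b = bot"
  shows "(\<lambda>z\<in>ms_points X. if z \<in> V then a else b) \<in> ms_hom X G"
proof (rule ms_homI)
  show "continuous_map (ms_topology X) (ms_topology G) (\<lambda>z\<in>ms_points X. if z \<in> V then a else b)"
    by (rule continuous_map_eq[OF continuous_map_if_clopen[OF assms(1-4)]]) simp
qed (use assms(5,6) in auto)

text \<open>The parallel pair compares the constant family \<open>True\<close> with the family of
  indicators of the clopens containing the image; they agree exactly on the intersection of these
  clopens, which is the closed image.\<close>

lemma regular_monic_if_inj_denom:
  fixes X :: "'x ms" and Y :: "'y ms"
  assumes X: "is_ms X" and Y: "is_ms Y" and m: "m \<in> ms_hom X Y"
    and inj: "inj_on m (ms_points X)"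
    and den: "\<And>x. x \<in> ms_points X \<Longrightarrow> denom X x \<le> denom Y (m x)"
  shows "regular_monic X Y m"
proof -
  let ?A = "m ` ms_points X"
  have clA: "closedin (ms_topology Y) ?A" using X Y m by (rule ms_hom_image_closedin)
  have bX: "boolean_space (ms_topology X)" and bY: "boolean_space (ms_topology Y)"
    using X Y by (auto simp: is_ms_def)
  define \<C> where "\<C> = {C. openin (ms_topology Y) C \<and> closedin (ms_topology Y) C \<and> ?A \<subseteq> C}"
  \<comment> \<open>With all denominators least, every continuous map into \<open>B\<close> is an
    arrow.\<close>
  define B where "B = discrete_ms (UNIV :: bool set) (\<lambda>_. bot)"
  define Z where "Z = ms_prod \<C> (\<lambda>_. B)"
  have B: "is_ms B" "ms_points B = UNIV" "\<And>x. denom B x = bot"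
    by (auto simp: B_def is_ms_discrete_ms)
  have Z: "is_ms Z" unfolding Z_def by (rule is_ms_ms_prod) (rule B(1))
  have into: "\<exists>u. u \<in> ms_hom Y Z \<and> (\<forall>y\<in>ms_points Y. \<forall>C\<in>\<C>. u y C = h C y)"
    if h: "\<And>C. C \<in> \<C> \<Longrightarrow> h C \<in> ms_hom Y B" for h
  proof -
    obtain u where u: "u \<in> ms_hom Y Z" and
      *: "\<forall>C\<in>\<C>. compose (ms_points Y) (\<lambda>x\<in>ms_points Z. x C) u = h C"
      using ms_prod_universal(2)[of \<C> "\<lambda>_. B" Y h] B(1) Y h unfolding Z_def by blast
    have "u y C = h C y" if "y \<in> ms_points Y" "C \<in> \<C>" for y C
    proof -
      have "compose (ms_points Y) (\<lambda>x\<in>ms_points Z. x C) u y = h C y" using * that by simp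
      then show ?thesis using that ms_homD(3)[OF u] by (simp add: compose_eq)
    qed
    with u show ?thesis by blast
  qed
  \<comment> \<open>The constant map \<open>True\<close>, written as a two-valued map for the clopen
    set of all points.\<close>
  have "(\<lambda>y\<in>ms_points Y. if y \<in> ms_points Y then True else False) \<in> ms_hom Y B"
    by (rule two_valued_ms_hom) (simp_all add: B)
  then obtain f where f: "f \<in> ms_hom Y Z" "\<And>y C. y \<in> ms_points Y \<Longrightarrow> C \<in> \<C> \<Longrightarrow> f y C"
    using into[of "\<lambda>_. \<lambda>y\<in>ms_points Y. if y \<in> ms_points Y then True else False"] by auto
  have "(\<lambda>y\<in>ms_points Y. if y \<in> C then True else False) \<in> ms_hom Y B" if "C \<in> \<C>" for C
    by (rule two_valued_ms_hom) (use that in \<open>auto simp: B \<C>_def\<close>)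
  then obtain g where g: "g \<in> ms_hom Y Z"
    "\<And>y C. y \<in> ms_points Y \<Longrightarrow> C \<in> \<C> \<Longrightarrow> g y C \<longleftrightarrow> y \<in> C"
    using into[of "\<lambda>C. \<lambda>y\<in>ms_points Y. if y \<in> C then True else False"] by auto
  have fg: "f y = g y \<longleftrightarrow> y \<in> ?A" if y: "y \<in> ms_points Y" for y
  proof
    assume "f y = g y"
    then have C: "y \<in> C" if "C \<in> \<C>" for C using f(2)[OF y that] g(2)[OF y that] by simp
    show "y \<in> ?A"
    proof (rule ccontr)
      assume "y \<notin> ?A"
      with y have "y \<in> ms_points Y - ?A" by simp
      from boolean_space_clopen_outside_closed[OF bY clA this] obtain C
        where "openin (ms_topology Y) C" "closedin (ms_topology Y) C" "?A \<subseteq> C" "y \<notin> C" .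
      with C[of C] show False by (simp add: \<C>_def)
    qed
  next
    assume A: "y \<in> ?A"
    have ext: "f y \<in> extensional \<C>" "g y \<in> extensional \<C>"
      using ms_homD(3)[OF f(1) y] ms_homD(3)[OF g(1) y] by (auto simp: Z_def ms_prod_def PiE_iff)
    show "f y = g y"
      by (rule extensionalityI[OF ext]) (use f(2) g(2) y A in \<open>auto simp: \<C>_def\<close>)
  qed
  \<comment> \<open>A continuous map from a compact to a Hausdorff space is closed, so the injective
    \<open>m\<close> has a continuous inverse \<open>k\<close> on its image. Factorisations through
    \<open>m\<close> are obtained by composing with \<open>k\<close>.\<close>
  have emb: "embedding_map (ms_topology X) (ms_topology Y) m"
    using injective_closed_imp_embedding_map[OF ms_homD(2)[OF m] continuous_imp_closed_map[OF
        ms_homD(2)[OF m] boolean_spaceD(1)[OF bX] boolean_spaceD(2)[OF bY]] inj] .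
  then obtain k where k: "homeomorphic_maps (ms_topology X) (subtopology (ms_topology Y) ?A) m k"
    unfolding embedding_map_def homeomorphic_map_maps by blast
  have "ms_equaliser X Y Z m f g"
    unfolding ms_equaliser_def
  proof (intro conjI allI impI X Y Z m f(1) g(1))
    show "compose (ms_points X) f m = compose (ms_points X) g m"
      unfolding compose_eq_compose_iff using fg ms_homD(3)[OF m] by blast
    fix W :: "'y ms" and h
    assume "is_ms W \<and> h \<in> ms_hom W Y \<and> compose (ms_points W) f h = compose (ms_points W) g h"
    then have h: "h \<in> ms_hom W Y" and "\<And>w. w \<in> ms_points W \<Longrightarrow> f (h w) = g (h w)"
      by (auto simp: compose_eq_compose_iff)
    then have hA: "h w \<in> ?A" if "w \<in> ms_points W" for w
      using fg ms_homD(3)[OF h] that by blast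
    let ?u = "compose (ms_points W) k h"
    have km: "k (m x) = x" if "x \<in> ms_points X" for x
      using k that by (simp add: homeomorphic_maps_def)
    have hc: "continuous_map (ms_topology W) (subtopology (ms_topology Y) ?A) h"
      using ms_homD(2)[OF h] hA by (auto simp: continuous_map_in_subtopology)
    have mk: "m (k (h w)) = h w" "k (h w) \<in> ms_points X" if "w \<in> ms_points W" for w
      using hA[OF that] km by auto
    have "continuous_map (ms_topology W) (ms_topology X) (k \<circ> h)"
      using hc k unfolding homeomorphic_maps_def by (blast intro: continuous_map_compose)
    then have "continuous_map (ms_topology W) (ms_topology X) ?u"
      by (rule continuous_map_eq) (simp add: compose_def)
    moreover have "denom X (?u w) \<le> denom W w" if "w \<in> ms_points W" for w
    proof -
      \<comment> \<open>Preservation of denominators by \<open>m\<close> is what makes the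
        continuous factor an arrow.\<close>
      have "denom X (k (h w)) \<le> denom Y (h w)" using den[of "k (h w)"] mk that by simp
      also have "\<dots> \<le> denom W w" using ms_homD(4)[OF h that] .
      finally show ?thesis using that by (simp add: compose_eq)
    qed
    ultimately have u: "?u \<in> ms_hom W X" by (intro ms_homI compose_extensional)
    have mu: "compose (ms_points W) m ?u = h"
      by (rule extensionalityI[OF compose_extensional ms_homD(1)[OF h]]) (simp add: compose_eq mk)
    show "\<exists>!u. u \<in> ms_hom W X \<and> compose (ms_points W) m u = h"
    proof (rule ex1I[of _ ?u])
      fix v assume v: "v \<in> ms_hom W X \<and> compose (ms_points W) m v = h"
      show "v = ?u"
      proof (rule extensionalityI[of _ "ms_points W"])
        fix w assume w: "w \<in> ms_points W"
        then have "m (v w) = h w" using v by (metis compose_eq)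
        then show "v w = ?u w" using km[of "v w"] ms_homD(3) v w by (metis compose_eq)
      qed (use v ms_homD(1) compose_extensional in blast)+
    qed (use u mu in blast)
  qed
  \<comment> \<open>\<open>Z\<close> lives on a function type; \<open>regular_monicI\<close> moves
    the codomain to the type \<open>'y + 'y\<close>.\<close>
  then show ?thesis by (rule regular_monicI)
qed

section \<open>The canonical arrow\<close>

lemma canonical_arrow_apply:
  assumes "x \<in> ms_points X" "G \<in> \<G>" "t \<in> ms_hom X G"
  shows "canonical_arrow \<G> X x (G, t) = t x"
  using assms by (simp add: canonical_arrow_def cogen_index_def)

text \<open>It coincides with the arrow that the universal property of the product yields for the
  family \<open>snd\<close>.\<close>

lemma canonical_arrow_in_ms_hom:
  assumes "\<forall>G\<in>\<G>. is_ms G" "is_ms X"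
  shows "canonical_arrow \<G> X \<in> ms_hom X (ms_prod (cogen_index \<G> X) fst)"
proof -
  let ?I = "cogen_index \<G> X" let ?P = "ms_prod ?I fst"
  have ms: "is_ms (fst i)" and hom: "snd i \<in> ms_hom X (fst i)" if "i \<in> ?I" for i
    using that assms(1) by (auto simp: cogen_index_def)
  obtain u where u: "u \<in> ms_hom X ?P"
    and *: "\<forall>i\<in>?I. compose (ms_points X) (\<lambda>x\<in>ms_points ?P. x i) u = snd i"
    using ms_prod_universal(2)[of ?I fst X snd] ms hom assms(2) by blast
  have "canonical_arrow \<G> X = u"
  proof (rule extensionalityI[OF _ ms_homD(1)[OF u]])
    fix x assume x: "x \<in> ms_points X"
    have ux: "u x \<in> ms_points ?P" using ms_homD(3)[OF u x] .
    show "canonical_arrow \<G> X x = u x"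
    proof (rule extensionalityI[of _ ?I])
      fix i assume i: "i \<in> ?I"
      have "compose (ms_points X) (\<lambda>x\<in>ms_points ?P. x i) u x = snd i x" using * i by simp
      then have "u x i = snd i x" using x ux by (simp add: compose_eq)
      then show "canonical_arrow \<G> X x i = u x i"
        using x i by (simp add: canonical_arrow_def case_prod_beta)
    qed (use x ux in \<open>auto simp: canonical_arrow_def ms_prod_def PiE_iff\<close>)
  qed (simp add: canonical_arrow_def)
  with u show ?thesis by simp
qed

lemma denom_canonical_arrow:
  assumes "\<forall>G\<in>\<G>. is_ms G" "is_ms X" "x \<in> ms_points X"
  shows "denom (ms_prod (cogen_index \<G> X) fst) (canonical_arrow \<G> X x) =
    (SUP (G, t)\<in>cogen_index \<G> X. denom G (t x))"
proof -
  have "canonical_arrow \<G> X x \<in> ms_points (ms_prod (cogen_index \<G> X) fst)"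
    using ms_homD(3)[OF canonical_arrow_in_ms_hom[OF assms(1,2)] assms(3)] .
  then show ?thesis
    using assms(3)
    by (auto simp: ms_prod_def canonical_arrow_def case_prod_beta intro!: SUP_cong)
qed

lemma regularly_cogeneratingD:
  fixes X :: "'x ms" and \<G> :: "'g ms set"
  assumes "regularly_cogenerating TYPE('x) \<G>" "\<forall>G\<in>\<G>. is_ms G" "is_ms X"
  shows "inj_on (canonical_arrow \<G> X) (ms_points X)"
    and "\<And>x. x \<in> ms_points X \<Longrightarrow> denom X x = (SUP (G, t)\<in>cogen_index \<G> X. denom G (t x))"
proof -
  let ?P = "ms_prod (cogen_index \<G> X) fst"
  have "regular_monic X ?P (canonical_arrow \<G> X)"
    using assms(1,3) unfolding regularly_cogenerating_def by blast
  then obtain Z :: "(('g ms \<times> ('x \<Rightarrow> 'g) \<Rightarrow> 'g) + ('g ms \<times> ('x \<Rightarrow> 'g) \<Rightarrow> 'g)) ms" and f g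
    where eq: "ms_equaliser X ?P Z (canonical_arrow \<G> X) f g"
    unfolding regular_monic_def by blast
  show "inj_on (canonical_arrow \<G> X) (ms_points X)" using eq by (rule ms_equaliser_inj)
  show "denom X x = (SUP (G, t)\<in>cogen_index \<G> X. denom G (t x))" if "x \<in> ms_points X" for x
    using ms_equaliser_denom[OF eq that] denom_canonical_arrow[OF assms(2,3) that] by simp
qed

section \<open>Necessity, by two-point multisets\<close>

text \<open>If both points of \<open>X\<close> have least denominator, so do their images under any
  arrow, and injectivity of the canonical arrow provides an arrow separating them.\<close>

lemma regularly_cogenerating_imp_pair_nu_1:
  fixes \<G> :: "'g ms set" and a b :: 'x
  assumes cogen: "regularly_cogenerating TYPE('x) \<G>" and ms: "\<forall>G\<in>\<G>. is_ms G" and ab: "a \<noteq> b"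
  shows "\<exists>G\<in>\<G>. \<exists>x\<in>ms_points G. \<exists>y\<in>ms_points G. x \<noteq> y \<and> denom G x = nu 1 \<and> denom G y = nu 1"
proof -
  define X where "X = discrete_ms {a, b} (\<lambda>_. bot)"
  have X: "is_ms X" by (simp add: X_def is_ms_discrete_ms)
  have mem: "a \<in> ms_points X" "b \<in> ms_points X" by (simp_all add: X_def)
  have "canonical_arrow \<G> X a \<noteq> canonical_arrow \<G> X b"
    using inj_onD[OF regularly_cogeneratingD(1)[OF cogen ms X] _ mem] ab by blast
  moreover have "canonical_arrow \<G> X a = canonical_arrow \<G> X b"
    if "\<forall>(G, t)\<in>cogen_index \<G> X. t a = t b"
    using that mem by (auto simp: canonical_arrow_def restrict_def fun_eq_iff)
  ultimately obtain G t where G: "G \<in> \<G>" and t: "t \<in> ms_hom X G" "t a \<noteq> t b"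
    by (auto simp: cogen_index_def)
  have "denom G (t z) = nu 1" if "z \<in> ms_points X" for z
    using ms_homD(4)[OF t(1) that] that unfolding nu_1
    by (auto simp: X_def bot_unique simp del: bot_apply)
  then show ?thesis using G t mem ms_homD(3)[OF t(1)] by blast
qed

text \<open>A supremum in \<open>enat\<close> that is at least a finite \<open>k \<ge> 1\<close> has
  a member that is at least \<open>k\<close>. Hence a single arrow already preserves the denominator
  of \<open>a\<close>, while \<open>b\<close> is sent to a point of least denominator.\<close>

lemma regularly_cogenerating_imp_pair_prime_power:
  fixes \<G> :: "'g ms set" and a b :: 'x
  assumes cogen: "regularly_cogenerating TYPE('x) \<G>" and ms: "\<forall>G\<in>\<G>. is_ms G" and ab: "a \<noteq> b"
    and p: "prime p" and k: "k \<ge> 1"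
  shows "\<exists>G\<in>\<G>. \<exists>x\<in>ms_points G. \<exists>y\<in>ms_points G.
    x \<noteq> y \<and> denom G x = nu (p ^ k) \<and> denom G y = nu 1"
proof -
  define X where "X = discrete_ms {a, b} (\<lambda>z. if z = a then nu (p ^ k) else bot)"
  have X: "is_ms X" by (simp add: X_def is_ms_discrete_ms)
  have mem: "a \<in> ms_points X" "b \<in> ms_points X" by (simp_all add: X_def)
  have da: "denom X a = nu (p ^ k)" and db: "denom X b = bot" using ab by (auto simp: X_def)
  obtain q where q: "nat_of_prime q = p" using p prime_of_nat_inverse by blast
  have "nu (p ^ k) q = enat k" using p q by (simp add: nu_prime_power_apply)
  then have "enat k \<le> (SUP i\<in>cogen_index \<G> X. denom (fst i) (snd i a) q)"
    using regularly_cogeneratingD(2)[OF cogen ms X mem(1)] da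
    by (simp add: case_prod_beta image_image)
  then obtain G t where G: "G \<in> \<G>" and t: "t \<in> ms_hom X G" and ge: "enat k \<le> denom G (t a) q"
    unfolding enat_le_SUP_iff[OF k] by (auto simp: cogen_index_def)
  \<comment> \<open>The upper bound holds because \<open>t\<close> is an arrow; for the lower one
    the coordinate \<open>q\<close> suffices, as \<open>nu (p ^ k)\<close> vanishes
    elsewhere.\<close>
  have "denom G (t a) = nu (p ^ k)"
    using ms_homD(4)[OF t mem(1)] ge nu_prime_power_le_iff[of q k] by (simp add: da q antisym)
  moreover have "denom G (t b) = nu 1"
    using ms_homD(4)[OF t mem(2)] unfolding nu_1 db by (rule bot.extremum_uniqueI)
  \<comment> \<open>The images of \<open>a\<close> and \<open>b\<close> are distinct because their
    denominators are; here \<open>k \<ge> 1\<close> matters.\<close>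
  moreover have "nu (p ^ k) \<noteq> nu 1"
  proof
    assume "nu (p ^ k) = nu 1"
    then have "nu (p ^ k) q = 0" unfolding nu_1 by (simp add: bot_enat_def)
    with \<open>nu (p ^ k) q = enat k\<close> k show False by (simp add: zero_enat_def)
  qed
  ultimately show ?thesis using G mem ms_homD(3)[OF t] by metis
qed

section \<open>Sufficiency, by two-valued arrows\<close>

lemma regularly_cogenerating_if_pairs:
  fixes \<G> :: "'g ms set"
  assumes ms: "\<forall>G\<in>\<G>. is_ms G"
    and pairs: "\<forall>n \<in> {1} \<union> {p ^ k | p k. prime p \<and> k \<ge> 1}.
      \<exists>G\<in>\<G>. \<exists>x\<in>ms_points G. \<exists>y\<in>ms_points G. x \<noteq> y \<and> denom G x = nu n \<and> denom G y = nu 1"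
  shows "regularly_cogenerating TYPE('x) \<G>"
  unfolding regularly_cogenerating_def
proof (intro allI impI regular_monic_if_inj_denom)
  fix X :: "'x ms"
  let ?m = "canonical_arrow \<G> X" and ?P = "ms_prod (cogen_index \<G> X) fst"
  assume X: "is_ms X"
  then show "is_ms X" .
  have bX: "boolean_space (ms_topology X)" using X by (simp add: is_ms_def)
  show "is_ms ?P" using ms by (intro is_ms_ms_prod) (auto simp: cogen_index_def)
  show "?m \<in> ms_hom X ?P" using ms X by (rule canonical_arrow_in_ms_hom)
  show "inj_on ?m (ms_points X)"
  proof (rule inj_onI, rule ccontr)
    fix x y assume x: "x \<in> ms_points X" and y: "y \<in> ms_points X" and eq: "?m x = ?m y" and "x \<noteq> y"
    have "closedin (ms_topology X) {x}"
      using x boolean_spaceD(2)[OF bX] by (simp add: closedin_Hausdorff_sing_eq)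
    then obtain C where C: "openin (ms_topology X) C" "closedin (ms_topology X) C" "x \<in> C" "y \<notin> C"
      using boolean_space_clopen_outside_closed[OF bX, of "{x}" y] y \<open>x \<noteq> y\<close> by blast
    \<comment> \<open>For \<open>n = 1\<close> both denominators are least, so any clopen
      \<open>C\<close> separating \<open>x\<close> from \<open>y\<close> gives an arrow doing the
      same.\<close>
    obtain G a b where G: "G \<in> \<G>" "a \<in> ms_points G" "b \<in> ms_points G" "a \<noteq> b"
      "denom G a = bot" "denom G b = bot"
      using bspec[OF pairs, of 1] unfolding nu_1 by blast
    let ?t = "\<lambda>z\<in>ms_points X. if z \<in> C then a else b"
    have "?t \<in> ms_hom X G" using C G by (intro two_valued_ms_hom) auto
    then have "?t x = ?t y"
      using canonical_arrow_apply[of _ X G \<G> ?t] x y G(1) eq by metis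
    with x y C G show False by simp
  qed
  fix x assume x: "x \<in> ms_points X"
  show "denom X x \<le> denom ?P (?m x)"
    unfolding denom_canonical_arrow[OF ms X x]
  proof (rule supernat_leI)
    fix p k let ?n = "nat_of_prime p ^ k"
    assume k: "k \<ge> (1::nat)" and le: "nu ?n \<le> denom X x"
    have pr: "prime (nat_of_prime p)" using nat_of_prime[of p] by simp
    have n: "?n \<ge> 1" using prime_gt_0_nat[OF pr] by (simp add: Suc_le_eq)
    \<comment> \<open>Continuity of the denominator makes this an open neighbourhood of
      \<open>x\<close>. On a clopen \<open>V\<close> inside it, the value \<open>a\<close> of
      denominator \<open>nu ?n\<close> is admissible.\<close>
    have "openin (ms_topology X) {z \<in> ms_points X. nu ?n \<le> denom X z}"
      using X n unfolding is_ms_def continuous_map_supernat_iff by blast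
    then obtain V where V: "openin (ms_topology X) V" "closedin (ms_topology X) V" "x \<in> V"
      "V \<subseteq> {z \<in> ms_points X. nu ?n \<le> denom X z}"
      using bX x le unfolding boolean_space_iff by (metis (mono_tags, lifting) mem_Collect_eq)
    obtain G a b where G: "G \<in> \<G>" "a \<in> ms_points G" "b \<in> ms_points G"
      "denom G a = nu ?n" "denom G b = bot"
      using bspec[OF pairs, of ?n] pr k unfolding nu_1 by blast
    let ?t = "\<lambda>z\<in>ms_points X. if z \<in> V then a else b"
    have "?t \<in> ms_hom X G" using V G by (intro two_valued_ms_hom) auto
    then have "(G, ?t) \<in> cogen_index \<G> X" using G(1) by (simp add: cogen_index_def)
    moreover have "denom G (?t x) = nu ?n" using x V(3) G(4) by simp
    ultimately show "nu ?n \<le> (SUP (G, t)\<in>cogen_index \<G> X. denom G (t x))"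
      by (intro SUP_upper2[of "(G, ?t)"]) simp_all
  qed
qed

theorem theorem3p12:
  fixes \<G> :: "'g ms set"
  assumes "\<forall>G\<in>\<G>. is_ms G"
    and "\<exists>a b :: 'x. a \<noteq> b"
  shows "regularly_cogenerating TYPE('x) \<G> \<longleftrightarrow>
    (\<forall>n \<in> {1} \<union> {p ^ k | p k. prime p \<and> k \<ge> 1}.
       \<exists>G\<in>\<G>. \<exists>x\<in>ms_points G. \<exists>y\<in>ms_points G.
         x \<noteq> y \<and> denom G x = nu n \<and> denom G y = nu 1)"
    (is "?L \<longleftrightarrow> (\<forall>n\<in>?N. ?pair n)")
proof
  \<comment> \<open>These elements are the points of the two-point test multisets.\<close>
  obtain a b :: 'x where ab: "a \<noteq> b" using assms(2) by blast
  assume L: ?L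
  show "\<forall>n\<in>?N. ?pair n"
  proof
    fix n assume "n \<in> ?N"
    then consider "n = 1" | p k where "n = p ^ k" "prime p" "k \<ge> 1" by blast
    then show "?pair n"
    proof cases
      case 1
      show ?thesis unfolding 1 using regularly_cogenerating_imp_pair_nu_1[OF L assms(1) ab] .
    next
      case (2 p k)
      show ?thesis
        unfolding 2(1) using regularly_cogenerating_imp_pair_prime_power[OF L assms(1) ab 2(2,3)] .
    qed
  qed
next
  assume "\<forall>n\<in>?N. ?pair n"
  with assms(1) show ?L by (rule regularly_cogenerating_if_pairs)
qed

end
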